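(* Let $A$ be a *-algebra and $V$ a vector space. Let $X\neq\emptyset$ be a set and $K: X\times X\to S_{\mathbb C}(V;A)$ a positive-definite kernel. Then there exist a vector space $W$ equipped with a positive, $A$-valued, $\mathbb C$-sesquilinear form $\langle\cdot|\cdot\rangle: W\times W\to A$, and a mapping $D: X\to \mathrm{Lin}_{\mathbb C}(V,W)$ such that $$K(x,x')(v,v')=\langle D(x)v\,|\,D(x')v'\rangle\qquad\text{for all } x,x'\in X,\ v,v'\in V.$$
   Context: All vector spaces and algebras are over $\mathbb C$. Algebras need not be unital. In a *-algebra $A$, an element $a$ is called positive, $a\ge 0$, if $a=\sum_{m=1}^p a_m^*a_m$ for some $p\in\mathbb N=\{1,2,\dots\}$ and $a_1,\dots,a_p\in A$. The matrix algebra $M_n(A)$ of $n\times n$ matrices over $A$ is a *-algebra with its usual operations, so its positive elements are finite sums of matrices $M^*M$ with $M\in M_n(A)$. $\mathrm{Lin}_{\mathbb C}(V,W)$ is the set of $\mathbb C$-linear maps $V\to W$. $S_{\mathbb C}(V;A)$ is the vector space of $\mathbb C$-sesquilinear maps $V\times V\to A$, antilinear in the first argument and linear in the second (the same convention applies to sesquilinear forms on $W$). A matrix $(s_{ij})_{i,j=1}^n$ with entries in $S_{\mathbb C}(V;A)$ is called positive if $\big(s_{ij}(v_i,v_j)\big)_{i,j=1}^n$ is a positive element of $M_n(A)$ for all $v_1,\dots,v_n\in V$. A mapping $K:X\times X\to S_{\mathbb C}(V;A)$ is a positive-definite kernel if for all $n\in\mathbb N$ and $x_1,\dots,x_n\in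 X$ the matrix $\big(K(x_i,x_j)\big)_{i,j=1}^n$ is positive. A sesquilinear form $\langle\cdot|\cdot\rangle: W\times W\to A$ is positive if $\langle w|w\rangle\ge 0$ for all $w\in W$. (The pair $(W,D)$ is called a Kolmogorov decomposition for $K$.) *)

theory Defs
  imports Complex_Main "HOL-Library.Poly_Mapping"
begin

text \<open>Complex vector spaces are types of class \<^class>\<open>ab_group_add\<close> together with an explicit scalar
  multiplication satisfying \<^locale>\<open>vector_space\<close>.\<close>

text \<open>The class \<^class>\<open>ring\<close> does not require a unit.\<close>

locale star_algebra = vector_space scale
  for scale :: "complex \<Rightarrow> 'a::ring \<Rightarrow> 'a" +
  fixes star :: "'a \<Rightarrow> 'a"
  assumes scale_mult_left: "scale c a * b = scale c (a * b)"
    and mult_scale_right: "a * scale c b = scale c (a * b)"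
    and star_add: "star (a + b) = star a + star b"
    and star_scale: "star (scale c a) = scale (cnj c) (star a)"
    and star_mult: "star (a * b) = star b * star a"
    and star_star: "star (star a) = a"

definition positive_elem :: "('a::ring \<Rightarrow> 'a) \<Rightarrow> 'a \<Rightarrow> bool" where
  "positive_elem star a \<longleftrightarrow>
    (\<exists>p\<ge>1. \<exists>b :: nat \<Rightarrow> 'a. a = (\<Sum>m=1..p. star (b m) * b m))"

text \<open>An \<open>n \<times> n\<close> matrix over \<open>'a\<close> is a function \<open>nat \<Rightarrow> nat \<Rightarrow> 'a\<close> of which only the entries with
  both indices below \<open>n\<close> are relevant.\<close>

definition matrix_mult :: "nat \<Rightarrow> (nat \<Rightarrow> nat \<Rightarrow> 'a::ring) \<Rightarrow> (nat \<Rightarrow> nat \<Rightarrow> 'a) \<Rightarrow> nat \<Rightarrow> nat \<Rightarrow> 'a" where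
  "matrix_mult n M N = (\<lambda>i j. \<Sum>k<n. M i k * N k j)"

definition matrix_star :: "('a \<Rightarrow> 'a) \<Rightarrow> (nat \<Rightarrow> nat \<Rightarrow> 'a) \<Rightarrow> nat \<Rightarrow> nat \<Rightarrow> 'a" where
  "matrix_star star M = (\<lambda>i j. star (M j i))"

definition positive_matrix :: "('a::ring \<Rightarrow> 'a) \<Rightarrow> nat \<Rightarrow> (nat \<Rightarrow> nat \<Rightarrow> 'a) \<Rightarrow> bool" where
  "positive_matrix star n S \<longleftrightarrow>
    (\<exists>p\<ge>1. \<exists>M :: nat \<Rightarrow> nat \<Rightarrow> nat \<Rightarrow> 'a. \<forall>i<n. \<forall>j<n.
      S i j = (\<Sum>m=1..p. matrix_mult n (matrix_star star (M m)) (M m) i j))"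

definition sesquilinear ::
  "(complex \<Rightarrow> 'v::ab_group_add \<Rightarrow> 'v) \<Rightarrow> (complex \<Rightarrow> 'a::ab_group_add \<Rightarrow> 'a) \<Rightarrow> ('v \<Rightarrow> 'v \<Rightarrow> 'a) \<Rightarrow> bool" where
  "sesquilinear scaleV scaleA s \<longleftrightarrow>
    (\<forall>u u' v. s (u + u') v = s u v + s u' v) \<and>
    (\<forall>c u v. s (scaleV c u) v = scaleA (cnj c) (s u v)) \<and>
    (\<forall>u. Vector_Spaces.linear scaleV scaleA (s u))"

definition positive_form_matrix ::
  "('a::ring \<Rightarrow> 'a) \<Rightarrow> nat \<Rightarrow> (nat \<Rightarrow> nat \<Rightarrow> 'v \<Rightarrow> 'v \<Rightarrow> 'a) \<Rightarrow> bool" where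
  "positive_form_matrix star n s \<longleftrightarrow>
    (\<forall>v :: nat \<Rightarrow> 'v. positive_matrix star n (\<lambda>i j. s i j (v i) (v j)))"

definition positive_definite_kernel ::
  "(complex \<Rightarrow> 'v::ab_group_add \<Rightarrow> 'v) \<Rightarrow> (complex \<Rightarrow> 'a::ring \<Rightarrow> 'a) \<Rightarrow> ('a \<Rightarrow> 'a) \<Rightarrow> 'x set
    \<Rightarrow> ('x \<Rightarrow> 'x \<Rightarrow> 'v \<Rightarrow> 'v \<Rightarrow> 'a) \<Rightarrow> bool" where
  "positive_definite_kernel scaleV scaleA star X K \<longleftrightarrow>
    (\<forall>x\<in>X. \<forall>x'\<in>X. sesquilinear scaleV scaleA (K x x')) \<and>
    (\<forall>n\<ge>1. \<forall>x :: nat \<Rightarrow> 'x. (\<forall>i<n. x i \<in> X) \<longrightarrow>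
      positive_form_matrix star n (\<lambda>i j. K (x i) (x j)))"

definition positive_form :: "('a::ring \<Rightarrow> 'a) \<Rightarrow> ('w \<Rightarrow> 'w \<Rightarrow> 'a) \<Rightarrow> bool" where
  "positive_form star form \<longleftrightarrow> (\<forall>w. positive_elem star (form w w))"

text \<open>The space \<open>W\<close> is the type \<open>'w\<close> with scalar multiplication \<open>scaleW\<close>.\<close>

definition kolmogorov_decomposition ::
  "(complex \<Rightarrow> 'v::ab_group_add \<Rightarrow> 'v) \<Rightarrow> (complex \<Rightarrow> 'a::ring \<Rightarrow> 'a) \<Rightarrow> ('a \<Rightarrow> 'a) \<Rightarrow> 'x set
    \<Rightarrow> ('x \<Rightarrow> 'x \<Rightarrow> 'v \<Rightarrow> 'v \<Rightarrow> 'a)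
    \<Rightarrow> (complex \<Rightarrow> 'w::ab_group_add \<Rightarrow> 'w) \<Rightarrow> ('w \<Rightarrow> 'w \<Rightarrow> 'a) \<Rightarrow> ('x \<Rightarrow> 'v \<Rightarrow> 'w) \<Rightarrow> bool" where
  "kolmogorov_decomposition scaleV scaleA star X K scaleW form D \<longleftrightarrow>
    vector_space scaleW \<and>
    sesquilinear scaleW scaleA form \<and>
    positive_form star form \<and>
    (\<forall>x\<in>X. Vector_Spaces.linear scaleV scaleW (D x)) \<and>
    (\<forall>x\<in>X. \<forall>x'\<in>X. \<forall>v v'. K x x' v v' = form (D x v) (D x' v'))"

end

theory Submission
  imports Defs
begin

text \<open>
  The space \<open>W\<close> is the algebraic direct sum of copies of \<open>V\<close> indexed by points, realised as the
  finitely supported functions \<open>f\<close> from points to \<open>V\<close>. The form extends the kernel biadditively,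
  \<open>\<langle>f|g\<rangle> = \<Sum>\<^sub>x \<Sum>\<^sub>y K x y (f x) (g y)\<close>, and \<open>D x v\<close> is the function with value \<open>v\<close> at \<open>x\<close> and
  \<open>0\<close> elsewhere. The type of points may contain points outside \<open>X\<close>, about which the kernel says
  nothing; they are left out of the sum, so that the form vanishes on functions supported there.

  The substance is positivity. If \<open>f\<close> lives on the points \<open>x\<^sub>1, \<dots>, x\<^sub>n\<close> of \<open>X\<close> with values
  \<open>v\<^sub>1, \<dots>, v\<^sub>n\<close>, then \<open>\<langle>f|f\<rangle>\<close> is the sum of all entries of the positive matrix \<open>S\<close> with
  entries \<open>K x\<^sub>i x\<^sub>j v\<^sub>i v\<^sub>j\<close>. In a unital algebra this sum would be \<open>e\<^sup>* S e\<close>, where \<open>e\<close> is the column of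
  ones. The algebra may lack a unit, but the resulting formula makes sense without
  one: for a single matrix \<open>M\<close>, the entries of \<open>M\<^sup>* M\<close> add up to
  \<open>\<Sum>\<^sub>k (\<Sum>\<^sub>i M\<^sub>k\<^sub>i)\<^sup>* (\<Sum>\<^sub>j M\<^sub>k\<^sub>j)\<close>, a sum of squares of the row sums
  (\<open>positive_elem_sum_entries\<close>).
\<close>

section \<open>Positive elements\<close>

lemma positive_elem_zero: "positive_elem star (0 :: 'a::ring)"
  unfolding positive_elem_def by (intro exI[of _ 1] conjI exI[of _ "\<lambda>_. 0"]) auto

lemma positive_elem_square: "positive_elem star (star a * a)"
  unfolding positive_elem_def by (intro exI[of _ 1] conjI exI[of _ "\<lambda>_. a"]) auto

lemma positive_elem_add:
  fixes a b :: "'a::ring"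
  assumes "positive_elem star a" "positive_elem star b"
  shows "positive_elem star (a + b)"
proof -
  obtain p and u :: "nat \<Rightarrow> 'a" where p: "p \<ge> 1" and a: "a = (\<Sum>m=1..p. star (u m) * u m)"
    using assms(1) unfolding positive_elem_def by blast
  obtain q and w :: "nat \<Rightarrow> 'a" where b: "b = (\<Sum>m=1..q. star (w m) * w m)"
    using assms(2) unfolding positive_elem_def by blast
  define t where "t m = (if m \<le> p then u m else w (m - p))" for m
  have "(\<Sum>m=1..p + q. star (t m) * t m)
      = (\<Sum>m=1..p. star (t m) * t m) + (\<Sum>m=p + 1..p + q. star (t m) * t m)"
    by (rule sum.ub_add_nat) simp
  also have "(\<Sum>m=1..p. star (t m) * t m) = a"
    unfolding a by (intro sum.cong) (auto simp: t_def)
  also have "(\<Sum>m=p + 1..p + q. star (t m) * t m) = (\<Sum>m=1..q. star (t (m + p)) * t (m + p))"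
    using sum.shift_bounds_cl_nat_ivl[of "\<lambda>m. star (t m) * t m" 1 p q] by (simp add: add.commute)
  also have "\<dots> = b"
    unfolding b by (intro sum.cong) (auto simp: t_def)
  finally have "a + b = (\<Sum>m=1..p + q. star (t m) * t m)" ..
  moreover have "p + q \<ge> 1"
    using p by simp
  ultimately show ?thesis
    unfolding positive_elem_def by blast
qed

lemma positive_elem_sum:
  assumes "\<And>i. i \<in> I \<Longrightarrow> positive_elem star (f i)"
  shows "positive_elem star (sum f I)"
  using assms
  by (induction I rule: infinite_finite_induct) (auto intro: positive_elem_zero positive_elem_add)

lemma (in star_algebra) star_sum: "star (sum f I) = (\<Sum>i\<in>I. star (f i))"
proof -
  have "star 0 = 0"
    using star_add[of 0 0] by simp
  then show ?thesis
    by (induction I rule: infinite_finite_induct) (auto simp: star_add)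
qed

text \<open>
  Summing \<open>M\<^sub>k\<^sub>i\<^sup>* M\<^sub>k\<^sub>j\<close> over \<open>i\<close> and \<open>j\<close> before \<open>k\<close> factors it as the square of the \<open>k\<close>-th row
  sum of \<open>M\<close>.
\<close>

lemma (in star_algebra) positive_elem_sum_entries:
  assumes "positive_matrix star n S"
  shows "positive_elem star (\<Sum>i<n. \<Sum>j<n. S i j)"
proof -
  obtain p and M :: "nat \<Rightarrow> nat \<Rightarrow> nat \<Rightarrow> 'a" where S: "\<forall>i<n. \<forall>j<n.
      S i j = (\<Sum>m=1..p. \<Sum>k<n. star (M m k i) * M m k j)"
    using assms unfolding positive_matrix_def matrix_mult_def matrix_star_def by blast
  have "(\<Sum>i<n. \<Sum>j<n. S i j) = (\<Sum>i<n. \<Sum>j<n. \<Sum>m=1..p. \<Sum>k<n. star (M m k i) * M m k j)"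
    by (intro sum.cong refl) (simp add: S)
  also have "\<dots> = (\<Sum>i<n. \<Sum>m=1..p. \<Sum>j<n. \<Sum>k<n. star (M m k i) * M m k j)"
    by (intro sum.cong refl sum.swap)
  also have "\<dots> = (\<Sum>m=1..p. \<Sum>i<n. \<Sum>j<n. \<Sum>k<n. star (M m k i) * M m k j)"
    by (rule sum.swap)
  also have "\<dots> = (\<Sum>m=1..p. \<Sum>i<n. \<Sum>k<n. \<Sum>j<n. star (M m k i) * M m k j)"
    by (intro sum.cong refl sum.swap)
  also have "\<dots> = (\<Sum>m=1..p. \<Sum>k<n. \<Sum>i<n. \<Sum>j<n. star (M m k i) * M m k j)"
    by (intro sum.cong refl sum.swap)
  also have "\<dots> = (\<Sum>m=1..p. \<Sum>k<n. star (\<Sum>i<n. M m k i) * (\<Sum>j<n. M m k j))"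
    by (simp add: sum_product star_sum)
  finally show ?thesis
    by (simp only: positive_elem_sum positive_elem_square)
qed

section \<open>The direct sum and the induced form\<close>

lemma sesquilinearD:
  assumes "sesquilinear scaleV scaleA s"
  shows "s (u + u') v = s u v + s u' v"
    and "s (scaleV c u) v = scaleA (cnj c) (s u v)"
    and "s u (v + v') = s u v + s u v'"
    and "s u (scaleV c v) = scaleA c (s u v)"
    and "s 0 v = 0"
    and "s u 0 = 0"
proof -
  show add_left: "s (u + u') v = s u v + s u' v" for u u' v
    using assms by (simp add: sesquilinear_def)
  show add_right: "s u (v + v') = s u v + s u v'" for u v v'
    using assms by (simp add: sesquilinear_def Vector_Spaces.linear_iff)
  show "s (scaleV c u) v = scaleA (cnj c) (s u v)" "s u (scaleV c v) = scaleA c (s u v)"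
    using assms by (simp_all add: sesquilinear_def Vector_Spaces.linear_iff)
  show "s 0 v = 0" "s u 0 = 0"
    using add_left[of 0 0 v] add_right[of u 0 0] by simp_all
qed

abbreviation keys :: "('x \<Rightarrow>\<^sub>0 'v::zero) \<Rightarrow> 'x set" where
  "keys \<equiv> Poly_Mapping.keys"

abbreviation lookup :: "('x \<Rightarrow>\<^sub>0 'v::zero) \<Rightarrow> 'x \<Rightarrow> 'v" where
  "lookup \<equiv> Poly_Mapping.lookup"

definition pointwise_scale :: "('c \<Rightarrow> 'v \<Rightarrow> 'v) \<Rightarrow> 'c \<Rightarrow> ('x \<Rightarrow>\<^sub>0 'v::zero) \<Rightarrow> ('x \<Rightarrow>\<^sub>0 'v)" where
  "pointwise_scale scale c f = Poly_Mapping.map (scale c) f"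

definition kernel_form ::
  "'x set \<Rightarrow> ('x \<Rightarrow> 'x \<Rightarrow> 'v \<Rightarrow> 'v \<Rightarrow> 'a) \<Rightarrow> ('x \<Rightarrow>\<^sub>0 'v::zero) \<Rightarrow> ('x \<Rightarrow>\<^sub>0 'v)
    \<Rightarrow> 'a::comm_monoid_add" where
  "kernel_form X K f g =
    (\<Sum>x\<in>keys f \<inter> X. \<Sum>y\<in>keys g \<inter> X. K x y (lookup f x) (lookup g y))"

context vector_space
begin

text \<open>\<^const>\<open>Poly_Mapping.map\<close> forces the value \<open>0\<close> off the support; this agrees with scaling
  there because \<open>scale c 0 = 0\<close>.\<close>

lemma lookup_pointwise_scale: "lookup (pointwise_scale scale c f) x = scale c (lookup f x)"
  by (simp add: pointwise_scale_def Poly_Mapping.map.rep_eq when_def)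

lemma keys_pointwise_scale: "keys (pointwise_scale scale c f) \<subseteq> keys f"
  by (auto simp: in_keys_iff lookup_pointwise_scale)

lemma vector_space_pointwise_scale:
  "vector_space (pointwise_scale scale :: 'a \<Rightarrow> ('x \<Rightarrow>\<^sub>0 'b) \<Rightarrow> ('x \<Rightarrow>\<^sub>0 'b))"
  by unfold_locales
    (auto intro!: poly_mapping_eqI
      simp: lookup_pointwise_scale lookup_add scale_right_distrib scale_left_distrib)

lemma linear_single: "Vector_Spaces.linear scale (pointwise_scale scale) (Poly_Mapping.single x)"
  unfolding Vector_Spaces.linear_iff
  by (auto intro!: poly_mapping_eqI vector_space_pointwise_scale vector_space_axioms
      simp: lookup_pointwise_scale lookup_single when_def single_add)

end

text \<open>
  The supports of \<open>f + g\<close> and of a multiple of \<open>f\<close> can be smaller than those of \<open>f\<close> and \<open>g\<close>.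
  Enlarging the index sets to a common finite one reduces identities for the form to termwise
  ones.
\<close>

lemma kernel_form_superset:
  assumes K: "\<And>x y. x \<in> X \<Longrightarrow> y \<in> X \<Longrightarrow> sesquilinear scaleV scaleA (K x y)"
    and S: "finite S" "S \<subseteq> X" "keys f \<inter> X \<subseteq> S"
    and T: "finite T" "T \<subseteq> X" "keys g \<inter> X \<subseteq> T"
  shows "kernel_form X K f g = (\<Sum>x\<in>S. \<Sum>y\<in>T. K x y (lookup f x) (lookup g y))"
proof -
  note zero = sesquilinearD(5,6)[OF K]
  have "kernel_form X K f g = (\<Sum>x\<in>keys f \<inter> X. \<Sum>y\<in>T. K x y (lookup f x) (lookup g y))"
    unfolding kernel_form_def
    using T zero by (intro sum.cong refl sum.mono_neutral_left) (auto simp: in_keys_iff subset_iff)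
  also have "\<dots> = (\<Sum>x\<in>S. \<Sum>y\<in>T. K x y (lookup f x) (lookup g y))"
  proof (rule sum.mono_neutral_left)
    show "\<forall>x\<in>S - keys f \<inter> X. (\<Sum>y\<in>T. K x y (lookup f x) (lookup g y)) = 0"
    proof
      fix x
      assume "x \<in> S - keys f \<inter> X"
      then have "x \<in> X" "lookup f x = 0"
        using S(2) by (auto simp: in_keys_iff)
      then show "(\<Sum>y\<in>T. K x y (lookup f x) (lookup g y)) = 0"
        using T(2) zero(1) by (intro sum.neutral) auto
    qed
  qed (use S in auto)
  finally show ?thesis .
qed

lemma kernel_form_single:
  assumes "\<And>x y. x \<in> X \<Longrightarrow> y \<in> X \<Longrightarrow> sesquilinear scaleV scaleA (K x y)"
    and "x \<in> X" "y \<in> X"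
  shows "kernel_form X K (Poly_Mapping.single x u) (Poly_Mapping.single y v) = K x y u v"
  using assms by (subst kernel_form_superset[where S = "{x}" and T = "{y}"]) auto

lemma sesquilinear_kernel_form:
  fixes scaleA :: "complex \<Rightarrow> 'a::ab_group_add \<Rightarrow> 'a"
    and scaleV :: "complex \<Rightarrow> 'v::ab_group_add \<Rightarrow> 'v"
  assumes A: "vector_space scaleA" and V: "vector_space scaleV"
    and K: "\<And>x y. x \<in> X \<Longrightarrow> y \<in> X \<Longrightarrow> sesquilinear scaleV scaleA (K x y)"
  shows "sesquilinear (pointwise_scale scaleV) scaleA (kernel_form X K)"
proof -
  interpret A: vector_space scaleA by (rule A)
  interpret V: vector_space scaleV by (rule V)
  note super = kernel_form_superset[of X scaleV scaleA K, OF K]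
  note K_add = sesquilinearD(1,3)[OF K]
  note K_scale = sesquilinearD(2,4)[OF K]
  have add_left: "kernel_form X K (f + f') g = kernel_form X K f g + kernel_form X K f' g"
    for f f' g
  proof -
    define S where "S = (keys f \<union> keys f') \<inter> X"
    define T where "T = keys g \<inter> X"
    have *: "kernel_form X K h g = (\<Sum>x\<in>S. \<Sum>y\<in>T. K x y (lookup h x) (lookup g y))"
      if "keys h \<subseteq> keys f \<union> keys f'" for h
      using that by (intro super) (auto simp: S_def T_def)
    have mem: "\<And>x. x \<in> S \<Longrightarrow> x \<in> X" "\<And>y. y \<in> T \<Longrightarrow> y \<in> X"
      by (auto simp: S_def T_def)
    then show ?thesis
      by (simp add: * Poly_Mapping.keys_add lookup_add K_add mem flip: sum.distrib)
  qed
  have add_right: "kernel_form X K g (f + f') = kernel_form X K g f + kernel_form X K g f'"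
    for f f' g
  proof -
    define S where "S = keys g \<inter> X"
    define T where "T = (keys f \<union> keys f') \<inter> X"
    have *: "kernel_form X K g h = (\<Sum>x\<in>S. \<Sum>y\<in>T. K x y (lookup g x) (lookup h y))"
      if "keys h \<subseteq> keys f \<union> keys f'" for h
      using that by (intro super) (auto simp: S_def T_def)
    have mem: "\<And>x. x \<in> S \<Longrightarrow> x \<in> X" "\<And>y. y \<in> T \<Longrightarrow> y \<in> X"
      by (auto simp: S_def T_def)
    then show ?thesis
      by (simp add: * Poly_Mapping.keys_add lookup_add K_add mem flip: sum.distrib)
  qed
  have scale_left:
    "kernel_form X K (pointwise_scale scaleV c f) g = scaleA (cnj c) (kernel_form X K f g)"
    and scale_right:
    "kernel_form X K f (pointwise_scale scaleV c g) = scaleA c (kernel_form X K f g)" for c f g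
  proof -
    define S where "S = keys f \<inter> X"
    define T where "T = keys g \<inter> X"
    have *: "kernel_form X K h k = (\<Sum>x\<in>S. \<Sum>y\<in>T. K x y (lookup h x) (lookup k y))"
      if "keys h \<subseteq> keys f" "keys k \<subseteq> keys g" for h k
      using that by (intro super) (auto simp: S_def T_def)
    have mem: "\<And>x. x \<in> S \<Longrightarrow> x \<in> X" "\<And>y. y \<in> T \<Longrightarrow> y \<in> X"
      by (auto simp: S_def T_def)
    then show
      "kernel_form X K (pointwise_scale scaleV c f) g = scaleA (cnj c) (kernel_form X K f g)"
      "kernel_form X K f (pointwise_scale scaleV c g) = scaleA c (kernel_form X K f g)"
      by (simp_all add: * V.keys_pointwise_scale V.lookup_pointwise_scale K_scale mem
          A.scale_sum_right)
  qed
  show ?thesis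
    unfolding sesquilinear_def Vector_Spaces.linear_iff
    using A V.vector_space_pointwise_scale add_left add_right scale_left scale_right by blast
qed

lemma positive_form_kernel_form:
  fixes K :: "'x \<Rightarrow> 'x \<Rightarrow> 'v::ab_group_add \<Rightarrow> 'v \<Rightarrow> 'a::ring"
  assumes A: "star_algebra scaleA star"
    and K: "positive_definite_kernel scaleV scaleA star X K"
  shows "positive_form star (kernel_form X K)"
  unfolding positive_form_def
proof
  fix f :: "'x \<Rightarrow>\<^sub>0 'v"
  define S where "S = keys f \<inter> X"
  show "positive_elem star (kernel_form X K f f)"
  proof (cases "S = {}")
    \<comment> \<open>Positivity of a kernel concerns nonempty lists of points, so an empty support is separate.\<close>
    case True
    then show ?thesis
      by (simp add: kernel_form_def S_def positive_elem_zero)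
  next
    case False
    have "finite S"
      by (simp add: S_def)
    then obtain x where x: "bij_betw x {..<card S} S"
      using ex_bij_betw_nat_finite[of S] by (auto simp: atLeast0LessThan)
    then have "x i \<in> X" if "i < card S" for i
      using that by (auto simp: bij_betw_def S_def)
    moreover have "card S \<ge> 1"
      using False \<open>finite S\<close> by (simp add: Suc_le_eq card_gt_0_iff)
    ultimately have "positive_form_matrix star (card S) (\<lambda>i j. K (x i) (x j))"
      using K by (simp add: positive_definite_kernel_def)
    then have "positive_matrix star (card S)
        (\<lambda>i j. K (x i) (x j) (lookup f (x i)) (lookup f (x j)))"
      by (simp add: positive_form_matrix_def)
    then have "positive_elem star
        (\<Sum>i<card S. \<Sum>j<card S. K (x i) (x j) (lookup f (x i)) (lookup f (x j)))"
      by (rule star_algebra.positive_elem_sum_entries[OF A])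
    also have "(\<Sum>i<card S. \<Sum>j<card S. K (x i) (x j) (lookup f (x i)) (lookup f (x j)))
        = (\<Sum>i<card S. \<Sum>y\<in>S. K (x i) y (lookup f (x i)) (lookup f y))"
      by (intro sum.cong refl sum.reindex_bij_betw[OF x])
    also have "\<dots> = kernel_form X K f f"
      unfolding kernel_form_def S_def[symmetric] by (rule sum.reindex_bij_betw[OF x])
    finally show ?thesis .
  qed
qed

theorem proposition3p1:
  fixes scaleA :: "complex \<Rightarrow> 'a::ring \<Rightarrow> 'a"
    and star :: "'a \<Rightarrow> 'a"
    and scaleV :: "complex \<Rightarrow> 'v::ab_group_add \<Rightarrow> 'v"
    and X :: "'x set"
    and K :: "'x \<Rightarrow> 'x \<Rightarrow> 'v \<Rightarrow> 'v \<Rightarrow> 'a"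
  assumes "star_algebra scaleA star"
    and "vector_space scaleV"
    and "X \<noteq> {}"
    and "positive_definite_kernel scaleV scaleA star X K"
  shows "\<exists>(scaleW :: complex \<Rightarrow> ('x \<Rightarrow>\<^sub>0 'v) \<Rightarrow> ('x \<Rightarrow>\<^sub>0 'v)) form D.
    kolmogorov_decomposition scaleV scaleA star X K scaleW form D"
proof -
  interpret A: star_algebra scaleA star by (rule assms(1))
  interpret V: vector_space scaleV by (rule assms(2))
  have K: "sesquilinear scaleV scaleA (K x y)" if "x \<in> X" "y \<in> X" for x y
    using assms(4) that by (simp add: positive_definite_kernel_def)
  have "kolmogorov_decomposition scaleV scaleA star X K
      (pointwise_scale scaleV) (kernel_form X K) Poly_Mapping.single"
    unfolding kolmogorov_decomposition_def
    using V.vector_space_pointwise_scale V.linear_single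
      sesquilinear_kernel_form[OF A.vector_space_axioms assms(2) K]
      positive_form_kernel_form[OF assms(1,4)]
      kernel_form_single[of X scaleV scaleA K, OF K]
    by (intro conjI ballI allI) auto
  then show ?thesis
    by blast
qed

end
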